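(* In vector-valued systems such as the linear $2\times 2$ hyperbolic system with random initial data $$\begin{cases}\partial_t\vec z(t,x;\omega)+D(x)\,\partial_x\vec z(t,x;\omega)=0,\\ \vec z(0,x,\omega)=\vec z_{(0,x)}(\omega),\end{cases}$$ the initial joint pointwise statistics $\{\phi_{0,x}\}_{x\in\mathbb{R}}$ are not sufficient to determine $\{\phi_{t,x}\}_{x\in\mathbb{R}}$ for $t>0$.
   Context: The parameter space $\Omega\subseteq\mathbb{R}^d$ is equipped with a Borel probability measure $\mu$, and $\omega\in\Omega$. The unknown $\vec z(t,x;\omega)$ takes values in $\mathbb{R}^2$, with one space variable $x\in\mathbb{R}$; $x\mapsto D(x)$ is a smooth map from $\mathbb{R}$ to the space of $2\times 2$ matrices, and each $D(x)$ is real diagonalizable. For each $x$, the initial datum $\vec z_{(0,x)}:\Omega\to\mathbb{R}^2$ is a measurable function. The (joint) pointwise statistics $\phi_{t,x}$ is the probability measure on $\mathbb{R}^2$ defined by $\phi_{t,x}(A)=\mu(\{\omega:\vec z(t,x;\omega)\in A\})$ for every measurable $A\subseteq\mathbb{R}^2$. *)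

theory Defs
  imports "HOL-Probability.Probability"
begin

text \<open>\<open>C\<^sup>\<infinity>\<close> on the whole line: \<open>F n\<close> is the \<open>n\<close>-th derivative of \<open>f\<close>.\<close>

definition smooth_on_reals :: "(real \<Rightarrow> 'a::real_normed_vector) \<Rightarrow> bool" where
  "smooth_on_reals f \<longleftrightarrow>
     (\<exists>F :: nat \<Rightarrow> real \<Rightarrow> 'a. F 0 = f \<and>
        (\<forall>n x. (F n has_vector_derivative F (Suc n) x) (at x)))"

definition real_diagonalizable :: "real^'n^'n \<Rightarrow> bool" where
  "real_diagonalizable A \<longleftrightarrow>
     (\<exists>P L :: real^'n^'n. invertible P \<and> (\<forall>i j. i \<noteq> j \<longrightarrow> L $ i $ j = 0) \<and>
        A = P ** L ** matrix_inv P)"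

text \<open>
  \<open>u t x\<close> is a classical solution of \<open>u\<^sub>t + D(x) u\<^sub>x = 0\<close>, \<open>u(0,x) = u0(x)\<close>, of class \<open>C\<^sup>1\<close> up to the
  initial time. Only \<open>t \<ge> 0\<close> matters; the time derivative at \<open>t = 0\<close> is one-sided.
\<close>

definition classical_solution ::
    "(real \<Rightarrow> real^2^2) \<Rightarrow> (real \<Rightarrow> real^2) \<Rightarrow> (real \<Rightarrow> real \<Rightarrow> real^2) \<Rightarrow> bool" where
  "classical_solution D u0 u \<longleftrightarrow>
     (\<forall>x. u 0 x = u0 x) \<and>
     (\<exists>ut ux :: real \<Rightarrow> real \<Rightarrow> real^2.
        continuous_on ({0..} \<times> UNIV) (\<lambda>(t, x). ut t x) \<and>
        continuous_on ({0..} \<times> UNIV) (\<lambda>(t, x). ux t x) \<and>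
        (\<forall>t\<ge>0. \<forall>x.
           ((\<lambda>s. u s x) has_vector_derivative ut t x) (at t within {0..}) \<and>
           ((\<lambda>y. u t y) has_vector_derivative ux t x) (at x) \<and>
           ut t x + D x *v ux t x = 0))"

text \<open>
  The initial datum determines the solution for \<open>t \<ge> 0\<close>. Without this, the statistics could fail to
  be determined merely because one datum has several solutions, which can happen when the entries
  of \<open>D\<close> grow too fast at infinity.
\<close>

definition unique_classical_solutions :: "(real \<Rightarrow> real^2^2) \<Rightarrow> bool" where
  "unique_classical_solutions D \<longleftrightarrow>
     (\<forall>u0 u v. classical_solution D u0 u \<longrightarrow> classical_solution D u0 v \<longrightarrow>
        (\<forall>t\<ge>0. \<forall>x. u t x = v t x))"

text \<open>
  \<open>z0 x \<omega>\<close> is the random initial datum and \<open>z t x \<omega>\<close> the random solution. Measurability of \<open>z t x\<close> is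
  what makes the pointwise statistics at \<open>(t, x)\<close> a probability measure.
\<close>

definition random_solution ::
    "(real \<Rightarrow> real^2^2) \<Rightarrow> 'w measure \<Rightarrow> (real \<Rightarrow> 'w \<Rightarrow> real^2) \<Rightarrow>
     (real \<Rightarrow> real \<Rightarrow> 'w \<Rightarrow> real^2) \<Rightarrow> bool" where
  "random_solution D M z0 z \<longleftrightarrow>
     (\<forall>x. z0 x \<in> borel_measurable M) \<and>
     (\<forall>t\<ge>0. \<forall>x. z t x \<in> borel_measurable M) \<and>
     (\<forall>\<omega>\<in>space M. classical_solution D (\<lambda>x. z0 x \<omega>) (\<lambda>t x. z t x \<omega>))"

definition pointwise_statistics ::
    "'w measure \<Rightarrow> (real \<Rightarrow> real \<Rightarrow> 'w \<Rightarrow> real^2) \<Rightarrow> real \<Rightarrow> real \<Rightarrow> (real^2) measure" where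
  "pointwise_statistics M z t x = distr M borel (z t x)"

text \<open>
  For the system given by \<open>D\<close> and the parameter space \<open>M\<close>, the family of initial statistics
  \<open>(\<phi>\<^bsub>0,x\<^esub>)\<close>, \<open>x \<in> \<real>\<close>, determines the family \<open>(\<phi>\<^bsub>t,x\<^esub>)\<close>, \<open>x \<in> \<real>\<close>, at time \<open>t\<close>.
\<close>

definition initial_statistics_determine ::
    "(real \<Rightarrow> real^2^2) \<Rightarrow> 'w measure \<Rightarrow> real \<Rightarrow> bool" where
  "initial_statistics_determine D M t \<longleftrightarrow>
     (\<forall>z0 z w0 w. random_solution D M z0 z \<longrightarrow> random_solution D M w0 w \<longrightarrow>
        (\<forall>x. pointwise_statistics M z 0 x = pointwise_statistics M w 0 x) \<longrightarrow>
        (\<forall>x. pointwise_statistics M z t x = pointwise_statistics M w t x))"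

end

theory Submission
  imports Defs
begin

text \<open>
  Take \<open>D = diag(-1, 1)\<close>, so that the first component travels to the left and the second one to the
  right. Multiply two bumps with disjoint supports, \<open>a\<close> on \<open>(0, \<infinity>)\<close> and \<open>b\<close> on \<open>(-\<infinity>, 0)\<close>, by a
  random sign \<open>X\<close>, and compare the initial data \<open>(X a, X b)\<close> and \<open>(X a, - X b)\<close>. At every single point
  one of the components vanishes, so that by the symmetry of \<open>X\<close> both data have the same pointwise
  statistics: the correlation between different points is invisible to them. At any time \<open>t > 0\<close> both
  bumps have reached the origin, where the components are equal almost surely for the first solution
  and opposite and nonzero for the second one.
\<close>

text \<open>Method of characteristics: along the line \<open>y s = x - c * t + c * s\<close> the
  chain rule gives the derivative \<open>ut + c * ux = 0\<close>. All derivatives in time are taken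
  within \<open>{0..}\<close>, since at the initial time only a one-sided one exists.\<close>

lemma transport_constant_along_characteristic:
  fixes u :: "real \<Rightarrow> real \<Rightarrow> real"
  assumes ut: "\<And>t x. t \<ge> 0 \<Longrightarrow> ((\<lambda>s. u s x) has_vector_derivative ut t x) (at t within {0..})"
    and ux: "\<And>t x. t \<ge> 0 \<Longrightarrow> ((\<lambda>y. u t y) has_vector_derivative ux t x) (at x)"
    and cont: "continuous_on ({0..} \<times> UNIV) (\<lambda>(t, x). ux t x)"
    and eq: "\<And>t x. t \<ge> 0 \<Longrightarrow> ut t x + c * ux t x = 0"
    and "t \<ge> 0"
  shows "u t x = u 0 (x - c * t)"
proof -
  define y where "y s = x - c * t + c * s" for s
  \<comment> \<open>Joint continuity of the x-derivative upgrades the two partial derivatives to a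
    total one, which the chain rule along the characteristic requires.\<close>
  have joint: "((\<lambda>(s, y). u s y) has_derivative (\<lambda>(a, b). a *\<^sub>R ut s y + ux s y * b))
      (at (s, y) within {0..} \<times> UNIV)" if "s \<ge> 0" for s y
  proof -
    have "((\<lambda>(s, y). u s y) has_derivative
        (\<lambda>(a, b). a *\<^sub>R ut s y + blinfun_apply (blinfun_mult_right (ux s y)) b))
      (at (s, y) within {0..} \<times> UNIV)"
    proof (rule has_derivative_partialsI[where fy = "\<lambda>s y. blinfun_mult_right (ux s y)"])
      show "((\<lambda>s. u s y) has_derivative (\<lambda>a. a *\<^sub>R ut s y)) (at s within {0..})"
        using ut[OF that] by (simp add: has_vector_derivative_def)
      show "(u r has_derivative blinfun_apply (blinfun_mult_right (ux r z))) (at z within UNIV)"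
        if "r \<in> {0..}" for r z
        using ux[of r z] that
        by (simp add: has_real_derivative_iff_has_vector_derivative[symmetric] has_field_derivative_def)
      have "continuous_on ({0..} \<times> UNIV) (\<lambda>p. blinfun_mult_right ((\<lambda>(t, x). ux t x) p))"
        by (intro bounded_linear.continuous_on[OF bounded_linear_blinfun_mult_right] cont)
      then show "continuous (at (s, y) within {0..} \<times> UNIV)
          (\<lambda>(x, y). blinfun_mult_right (ux x y))"
        using that by (simp add: continuous_on_eq_continuous_within split_def)
    qed auto
    then show ?thesis
      by simp
  qed
  have "((\<lambda>s. u s (y s)) has_derivative (\<lambda>h. 0)) (at s within {0..})" if "s \<in> {0..}" for s
  proof -
    have "((\<lambda>s. (s, y s)) has_derivative (\<lambda>h. (h, c * h))) (at s within {0..})"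
      unfolding y_def by (auto intro!: derivative_eq_intros)
    \<comment> \<open>The chain rule asks for the derivative within the image of the path, which
      stays in the closed half-plane.\<close>
    moreover have "((\<lambda>(s, y). u s y) has_derivative (\<lambda>(a, b). a *\<^sub>R ut s (y s) + ux s (y s) * b))
      (at (s, y s) within (\<lambda>s. (s, y s)) ` {0..})"
      by (rule has_derivative_subset[OF joint]) (use that in auto)
    ultimately have "((\<lambda>s. u s (y s)) has_derivative
        (\<lambda>h. h *\<^sub>R ut s (y s) + ux s (y s) * (c * h))) (at s within {0..})"
      by (drule_tac has_derivative_in_compose) auto
    moreover have "h *\<^sub>R ut s (y s) + ux s (y s) * (c * h) = 0" for h
    proof -
      have "h *\<^sub>R ut s (y s) + ux s (y s) * (c * h) = h * (ut s (y s) + c * ux s (y s))"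
        by (simp add: algebra_simps)
      then show ?thesis
        using eq that by simp
    qed
    ultimately show ?thesis
      by simp
  qed
  then obtain k where "\<And>s. s \<in> {0..} \<Longrightarrow> u s (y s) = k"
    using has_derivative_zero_constant[of "{0..}" "\<lambda>s. u s (y s)"] by auto
  from this[of t] this[of 0] \<open>t \<ge> 0\<close> show ?thesis
    by (simp add: y_def)
qed

definition diag_matrix :: "real^'n \<Rightarrow> real^'n^'n" where
  "diag_matrix c = (\<chi> i j. if i = j then c $ i else 0)"

lemma diag_matrix_mult_vec: "(diag_matrix c *v v) $ i = c $ i * v $ i"
  by (simp add: diag_matrix_def matrix_vector_mult_def if_distrib[of "\<lambda>a. a * _"] cong: if_cong)

lemma real_diagonalizable_diag_matrix:
  fixes c :: "real^'n"
  shows "real_diagonalizable (diag_matrix c)"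
  unfolding real_diagonalizable_def
proof (intro exI conjI)
  have "matrix_inv (mat 1 :: real^'n^'n) = mat 1"
    by (simp add: matrix_inv_def)
  then show "diag_matrix c = mat 1 ** diag_matrix c ** matrix_inv (mat 1 :: real^'n^'n)"
    by simp
qed (auto simp: diag_matrix_def invertible_def)

lemma smooth_on_reals_const: "smooth_on_reals (\<lambda>x. c)"
  unfolding smooth_on_reals_def
  by (rule exI[of _ "\<lambda>n x. if n = 0 then c else 0"]) auto

text \<open>A diagonal system decouples: row \<open>i\<close> is a scalar transport equation with
  speed \<open>c $ i\<close>. The explicit formula makes the solution unique.\<close>

lemma classical_solution_diag_matrix:
  assumes "classical_solution (\<lambda>x. diag_matrix c) u0 u" "t \<ge> 0"
  shows "u t x $ i = u0 (x - c $ i * t) $ i"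
proof -
  obtain ut ux where
      cont: "continuous_on ({0..} \<times> UNIV) (\<lambda>(t, x). ux t x)"
    and ut: "\<And>t x. t \<ge> 0 \<Longrightarrow> ((\<lambda>s. u s x) has_vector_derivative ut t x) (at t within {0..})"
    and ux: "\<And>t x. t \<ge> 0 \<Longrightarrow> ((\<lambda>y. u t y) has_vector_derivative ux t x) (at x)"
    and eq: "\<And>t x. t \<ge> 0 \<Longrightarrow> ut t x + diag_matrix c *v ux t x = 0"
    and init: "\<And>x. u 0 x = u0 x"
    using assms(1) unfolding classical_solution_def by blast
  have "u t x $ i = u 0 (x - c $ i * t) $ i"
  proof (rule transport_constant_along_characteristic)
    show "((\<lambda>s. u s x $ i) has_vector_derivative ut t x $ i) (at t within {0..})"
      if "t \<ge> 0" for t x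
      by (rule bounded_linear.has_vector_derivative[OF bounded_linear_vec_nth ut[OF that]])
    show "((\<lambda>y. u t y $ i) has_vector_derivative ux t x $ i) (at x)" if "t \<ge> 0" for t x
      by (rule bounded_linear.has_vector_derivative[OF bounded_linear_vec_nth ux[OF that]])
    show "continuous_on ({0..} \<times> UNIV) (\<lambda>(t, x). ux t x $ i)"
      using continuous_on_component[OF cont, of i] by (simp add: split_def)
    show "ut t x $ i + c $ i * ux t x $ i = 0" if "t \<ge> 0" for t x
      using arg_cong[OF eq[OF that, of x], of "\<lambda>v. v $ i"] by (simp add: diag_matrix_mult_vec)
  qed fact
  then show ?thesis
    by (simp add: init)
qed

lemma unique_classical_solutions_diag_matrix: "unique_classical_solutions (\<lambda>x. diag_matrix c)"
  unfolding unique_classical_solutions_def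
  by (auto simp: vec_eq_iff classical_solution_diag_matrix)

text \<open>The existence side: any two C^1 profiles, each carried along its own coordinate axis
  with its own speed, form a classical solution.\<close>

lemma classical_solution_travelling_waves:
  fixes f g :: "real \<Rightarrow> real" and c :: "real^2"
  defines "wave \<equiv> \<lambda>t x. f (x - c $ 1 * t) *\<^sub>R axis 1 1 + g (x - c $ 2 * t) *\<^sub>R axis 2 1"
  assumes f: "\<And>x. (f has_real_derivative f' x) (at x)" and f': "continuous_on UNIV f'"
    and g: "\<And>x. (g has_real_derivative g' x) (at x)" and g': "continuous_on UNIV g'"
  shows "classical_solution (\<lambda>x. diag_matrix c) (wave 0) wave"
proof -
  define ut :: "real \<Rightarrow> real \<Rightarrow> real^2" where "ut t x =
    (- c $ 1 * f' (x - c $ 1 * t)) *\<^sub>R axis 1 1 + (- c $ 2 * g' (x - c $ 2 * t)) *\<^sub>R axis 2 1" for t x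
  define ux :: "real \<Rightarrow> real \<Rightarrow> real^2" where "ux t x =
    f' (x - c $ 1 * t) *\<^sub>R axis 1 1 + g' (x - c $ 2 * t) *\<^sub>R axis 2 1" for t x
  have chain_t: "((\<lambda>s. h (x - k * s)) has_real_derivative - k * h' (x - k * t)) (at t within S)"
    if "\<And>x. (h has_real_derivative h' x) (at x)" for h h' :: "real \<Rightarrow> real" and x k t S
    by (rule DERIV_chain2[OF that, THEN DERIV_cong]) (auto intro!: derivative_eq_intros)
  have chain_x: "((\<lambda>y. h (y - k * t)) has_real_derivative h' (x - k * t)) (at x)"
    if "\<And>x. (h has_real_derivative h' x) (at x)" for h h' :: "real \<Rightarrow> real" and x k t
    by (rule DERIV_chain2[OF that, THEN DERIV_cong]) (auto intro!: derivative_eq_intros)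
  have cont: "continuous_on ({0..} \<times> UNIV) (\<lambda>p. h (snd p - k * fst p))"
    if "continuous_on UNIV h" for h :: "real \<Rightarrow> real" and k
    by (rule continuous_on_compose2[OF that]) (auto intro!: continuous_intros)
  have "continuous_on ({0..} \<times> UNIV) (\<lambda>(t, x). ut t x)"
    unfolding ut_def split_def by (intro continuous_intros cont f' g')
  moreover have "continuous_on ({0..} \<times> UNIV) (\<lambda>(t, x). ux t x)"
    unfolding ux_def split_def by (intro continuous_intros cont f' g')
  moreover have "((\<lambda>s. wave s x) has_vector_derivative ut t x) (at t within {0..})" for t x
    unfolding wave_def ut_def
    by (rule has_vector_derivative_eq_rhs, rule derivative_intros,
        (rule derivative_intros chain_t f g)+) simp
  moreover have "((\<lambda>y. wave t y) has_vector_derivative ux t x) (at x)" for t x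
    unfolding wave_def ux_def
    by (rule has_vector_derivative_eq_rhs, rule derivative_intros,
        (rule derivative_intros chain_x f g)+) simp
  moreover have "ut t x + diag_matrix c *v ux t x = 0" for t x
    by (simp add: vec_eq_iff diag_matrix_mult_vec ut_def ux_def axis_def forall_2)
  ultimately show ?thesis
    unfolding classical_solution_def by blast
qed

text \<open>Squaring smooths the kink of the positive part at 0, so this profile is C^1 and still
  vanishes on a half-line.\<close>

lemma has_real_derivative_max_0_squared:
  "((\<lambda>y. (max 0 y)\<^sup>2) has_real_derivative 2 * max 0 y) (at y)"
proof (cases y "0 :: real" rule: linorder_cases)
  case less
  show ?thesis
    by (rule has_field_derivative_transform_within_open[of "\<lambda>y. 0" _ _ "{..<0}"]) (use less in auto)
next
  case equal
  show ?thesis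
    unfolding CARAT_DERIV equal
    \<comment> \<open>Caratheodory's criterion at 0: \<open>(max 0 y)\<^sup>2 = max 0 y * y\<close>,
      so the slope function is \<open>max 0\<close>, continuous with value 0.\<close>
    by (rule exI[of _ "max 0"]) (auto simp: max_def power2_eq_square intro!: continuous_intros)
next
  case greater
  show ?thesis
    by (rule has_field_derivative_transform_within_open[of "\<lambda>y. y\<^sup>2" _ _ "{0<..}"])
      (use greater in \<open>auto intro!: derivative_eq_intros\<close>)
qed

text \<open>The sign \<open>e = \<plusminus>1\<close> distinguishes the two solutions to be compared.\<close>

definition bump_pair :: "real \<Rightarrow> real \<Rightarrow> real \<Rightarrow> real \<Rightarrow> real^2" where
  "bump_pair e X t x =
     (X * (max 0 (x + t))\<^sup>2) *\<^sub>R axis 1 1 + (e * X * (max 0 (t - x))\<^sup>2) *\<^sub>R axis 2 1"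

lemma classical_solution_bump_pair:
  "classical_solution (\<lambda>x. diag_matrix (vector [-1, 1])) (bump_pair e X 0) (bump_pair e X)"
proof -
  \<comment> \<open>These are the profiles at time 0; with speeds -1 and 1, the components at time
    \<open>t\<close> are \<open>?f (x + t)\<close> and \<open>?g (x - t)\<close>.\<close>
  let ?f = "\<lambda>y. X * (max 0 y)\<^sup>2" and ?g = "\<lambda>y. e * X * (max 0 (- y))\<^sup>2"
  have f: "(?f has_real_derivative X * (2 * max 0 y)) (at y)" for y
    by (intro DERIV_cmult has_real_derivative_max_0_squared)
  have g: "(?g has_real_derivative e * X * (2 * max 0 (- y) * (- 1))) (at y)" for y
    by (intro DERIV_cmult DERIV_chain2[OF has_real_derivative_max_0_squared])
      (auto intro!: derivative_eq_intros)
  have "continuous_on UNIV (\<lambda>y::real. X * (2 * max 0 y))"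
    and "continuous_on UNIV (\<lambda>y::real. e * X * (2 * max 0 (- y) * (- 1)))"
    by (intro continuous_intros)+
  note classical_solution_travelling_waves[OF f this(1) g this(2), of "vector [-1, 1]"]
  then show ?thesis
    by (simp add: bump_pair_def[abs_def])
qed

text \<open>A permutation of a finite set preserves cardinalities, hence the uniform measure. With
  negation as the permutation, this is the symmetry of the random sign.\<close>

lemma distr_uniform_count_measure_reindex:
  assumes "finite A" "bij_betw h A A" "space N = UNIV"
  shows "distr (uniform_count_measure A) N (\<lambda>\<omega>. f (h \<omega>)) = distr (uniform_count_measure A) N f"
proof (rule measure_eqI)
  fix B assume "B \<in> sets (distr (uniform_count_measure A) N (\<lambda>\<omega>. f (h \<omega>)))"
  then have B: "B \<in> sets N"
    by simp
  have meas: "g \<in> measurable (uniform_count_measure A) N" for g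
    using assms(3) by (auto simp: measurable_def sets_uniform_count_measure space_uniform_count_measure)
  have inj: "inj_on h A" and img: "h ` A = A"
    using assms(2) by (auto simp: bij_betw_def)
  have "h ` ((\<lambda>\<omega>. f (h \<omega>)) -` B \<inter> A) = f -` B \<inter> h ` A"
    by auto
  then have "f -` B \<inter> A = h ` ((\<lambda>\<omega>. f (h \<omega>)) -` B \<inter> A)"
    by (simp only: img)
  moreover have "inj_on h ((\<lambda>\<omega>. f (h \<omega>)) -` B \<inter> A)"
    by (rule inj_on_subset[OF inj]) auto
  ultimately have "card (f -` B \<inter> A) = card ((\<lambda>\<omega>. f (h \<omega>)) -` B \<inter> A)"
    by (simp add: card_image)
  then show "emeasure (distr (uniform_count_measure A) N (\<lambda>\<omega>. f (h \<omega>))) B =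
      emeasure (distr (uniform_count_measure A) N f) B"
    using assms(1) B
    by (simp add: emeasure_distr[OF meas] emeasure_uniform_count_measure space_uniform_count_measure)
qed simp

theorem proposition4p1:
  shows "\<exists>(D :: real \<Rightarrow> real^2^2) (\<Omega> :: (real^'d) set) (\<mu> :: (real^'d) measure).
    smooth_on_reals D \<and> (\<forall>x. real_diagonalizable (D x)) \<and> unique_classical_solutions D \<and>
    prob_space \<mu> \<and> sets \<mu> = sets (restrict_space borel \<Omega>) \<and>
    (\<forall>t>0. \<not> initial_statistics_determine D \<mu> t)"
proof -
  define D :: "real \<Rightarrow> real^2^2" where "D = (\<lambda>x. diag_matrix (vector [-1, 1]))"
  \<comment> \<open>The two points are the all-ones vector and its negative, so under the uniform
    measure every coordinate is a fair random sign.\<close>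
  define \<Omega> :: "(real^'d) set" where "\<Omega> = {1, -1}"
  define \<mu> where "\<mu> = uniform_count_measure \<Omega>"
  fix k :: 'd
  define z where "z e t x \<omega> = bump_pair e (\<omega> $ k) t x" for e t x and \<omega> :: "real^'d"
  have [simp]: "finite \<Omega>" "\<Omega> \<noteq> {}"
    by (auto simp: \<Omega>_def)
  have space: "space \<mu> = \<Omega>"
    by (simp add: \<mu>_def space_uniform_count_measure)
  interpret prob_space \<mu>
    unfolding \<mu>_def by (rule prob_space_uniform_count_measure) auto
  have sets: "sets \<mu> = sets (restrict_space borel \<Omega>)"
  proof -
    \<comment> \<open>Finite sets are closed, so the trace of the Borel sets on
      \<open>\<Omega>\<close> is its power set.\<close>
    have "B \<in> sets borel" if "B \<subseteq> \<Omega>" for B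
      using finite_subset[OF that] by (auto intro: borel_closed finite_imp_closed)
    then show ?thesis
      by (auto simp: \<mu>_def sets_uniform_count_measure sets_restrict_space)
  qed
  have meas: "f \<in> borel_measurable \<mu>" for f :: "real^'d \<Rightarrow> real^2"
    by (auto simp: measurable_def \<mu>_def sets_uniform_count_measure space_uniform_count_measure)
  have sol: "random_solution D \<mu> (z e 0) (z e)" for e
    unfolding random_solution_def D_def z_def
    using classical_solution_bump_pair by (auto simp: meas)
  have init: "pointwise_statistics \<mu> (z 1) 0 x = pointwise_statistics \<mu> (z (-1)) 0 x" for x
  proof (cases "x \<ge> 0")
    case True
    \<comment> \<open>The second component, the only one containing \<open>e\<close>, vanishes
      here.\<close>
    then have "z 1 0 x = z (-1) 0 x"
      by (simp add: fun_eq_iff z_def bump_pair_def)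
    then show ?thesis
      by (simp add: pointwise_statistics_def)
  next
    case False
    \<comment> \<open>Only the second component survives, so changing \<open>e\<close> amounts to
      flipping the random sign.\<close>
    then have "z (-1) 0 x = (\<lambda>\<omega>. z 1 0 x (- \<omega>))"
      by (simp add: fun_eq_iff z_def bump_pair_def)
    moreover have "bij_betw uminus \<Omega> \<Omega>"
      by (auto simp: bij_betw_def \<Omega>_def)
    ultimately show ?thesis
      by (simp add: pointwise_statistics_def \<mu>_def distr_uniform_count_measure_reindex)
  qed
  have "\<not> initial_statistics_determine D \<mu> t" if "t > 0" for t
  proof
    assume "initial_statistics_determine D \<mu> t"
    then have eq: "pointwise_statistics \<mu> (z 1) t 0 = pointwise_statistics \<mu> (z (-1)) t 0"
      using sol[of 1] sol[of "-1"] init unfolding initial_statistics_determine_def by blast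
    \<comment> \<open>The diagonal is the test event: at the origin the values are
      \<open>X * t\<^sup>2\<close> and \<open>e * X * t\<^sup>2\<close>, so it has probability 1 for
      \<open>e = 1\<close> and, as \<open>t\<close> and \<open>X\<close> are nonzero, probability 0
      for \<open>e = -1\<close>.\<close>
    define B where "B = {v :: real^2. v $ 1 = v $ 2}"
    have B: "B \<in> sets borel"
      unfolding B_def by (intro borel_closed closed_Collect_eq continuous_intros)
    have "z 1 t 0 -` B \<inter> \<Omega> = \<Omega>"
      by (auto simp: z_def bump_pair_def B_def axis_def)
    moreover have "z (-1) t 0 -` B \<inter> \<Omega> = {}"
      using that by (auto simp: z_def bump_pair_def B_def axis_def \<Omega>_def)
    ultimately have "emeasure (pointwise_statistics \<mu> (z 1) t 0) B = 1"
      and "emeasure (pointwise_statistics \<mu> (z (-1)) t 0) B = 0"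
      using emeasure_space_1
      by (simp_all add: pointwise_statistics_def emeasure_distr[OF meas B] space)
    with eq show False
      by simp
  qed
  moreover have "smooth_on_reals D" "\<forall>x. real_diagonalizable (D x)" "unique_classical_solutions D"
    unfolding D_def by (simp_all add: smooth_on_reals_const real_diagonalizable_diag_matrix
        unique_classical_solutions_diag_matrix)
  ultimately show ?thesis
    using prob_space_axioms sets by (intro exI[of _ D] exI[of _ \<Omega>] exI[of _ \<mu>]) simp
qed

end
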